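(* Let $p$ be an odd prime, let $C_p=\{z\in S^1 : z^p=1\}$ be the subgroup of $p$-th roots of unity in the circle group $S^1$, and let $\phi\colon C_p\hookrightarrow S^1$ be the inclusion. Let $n,m$ be positive integers, let $C_p$ act on $S^{2n-1}\subset\mathbb{C}^n$ by scalar multiplication, and let $S^1$ act on $S^{2m-1}\subset\mathbb{C}^m$ by scalar multiplication. Then there exists a $\phi$-equivariant map $S^{2n-1}\to S^{2m-1}$ if and only if $n\le m$.
   Context: For a continuous homomorphism $\phi\colon G\to H$ of compact Lie groups, a $G$-space $X$ and an $H$-space $Y$, a map $f\colon X\to Y$ is $\phi$-equivariant if it is continuous and $f(gx)=\phi(g)f(x)$ for all $g\in G$, $x\in X$. *)

theory Defs
  imports "HOL-Analysis.Analysis" "HOL-Algebra.Coset" "HOL-Computational_Algebra.Primes"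
begin

(* Topological groups and spaces are taken to be carried by subsets of ambient topological
   types, with the subspace topology; an action is a curried function that is only
   constrained on the carriers. *)

definition G_space ::
    "('g::topological_space, 'r) monoid_scheme \<Rightarrow> ('g \<Rightarrow> 'x \<Rightarrow> 'x) \<Rightarrow> 'x::topological_space set \<Rightarrow> bool" where
  "G_space G act X \<longleftrightarrow>
     group G \<and>
     (\<forall>g\<in>carrier G. \<forall>x\<in>X. act g x \<in> X) \<and>
     (\<forall>x\<in>X. act \<one>\<^bsub>G\<^esub> x = x) \<and>
     (\<forall>g\<in>carrier G. \<forall>h\<in>carrier G. \<forall>x\<in>X. act (g \<otimes>\<^bsub>G\<^esub> h) x = act g (act h x)) \<and>
     continuous_on (carrier G \<times> X) (\<lambda>(g, x). act g x)"

(* The standing assumptions (phi a continuous homomorphism, X a G-space, Y an H-space) are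
   conjuncts; lemma equivariant_map_spheres_iff shows that they hold in the case of interest. *)
definition equivariant_map ::
    "('g::topological_space, 'r) monoid_scheme \<Rightarrow> ('h::topological_space, 's) monoid_scheme \<Rightarrow>
     ('g \<Rightarrow> 'h) \<Rightarrow>
     ('g \<Rightarrow> 'x \<Rightarrow> 'x) \<Rightarrow> 'x::topological_space set \<Rightarrow>
     ('h \<Rightarrow> 'y \<Rightarrow> 'y) \<Rightarrow> 'y::topological_space set \<Rightarrow> ('x \<Rightarrow> 'y) \<Rightarrow> bool" where
  "equivariant_map G H \<phi> actX X actY Y f \<longleftrightarrow>
     \<phi> \<in> hom G H \<and> continuous_on (carrier G) \<phi> \<and> G_space G actX X \<and> G_space H actY Y \<and>
     continuous_on X f \<and> f \<in> X \<rightarrow> Y \<and>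
     (\<forall>g\<in>carrier G. \<forall>x\<in>X. f (actX g x) = actY (\<phi> g) (f x))"

definition circle_group :: "complex monoid" where
  "circle_group = \<lparr>carrier = sphere 0 1, mult = (*), one = 1\<rparr>"

definition root_group :: "nat \<Rightarrow> complex monoid" where
  "root_group p = circle_group\<lparr>carrier := {z \<in> carrier circle_group. z ^ p = 1}\<rparr>"

(* The unit sphere of complex ^ 'n is taken for the Euclidean norm, so it is the sphere of real
   dimension 2 CARD('n) - 1. *)

lemma group_circle_group: "group circle_group"
proof (rule groupI)
  fix x assume "x \<in> carrier circle_group"
  then show "\<exists>y\<in>carrier circle_group. y \<otimes>\<^bsub>circle_group\<^esub> x = \<one>\<^bsub>circle_group\<^esub>"
    by (intro bexI[of _ "inverse x"]) (auto simp: circle_group_def norm_inverse intro!: left_inverse)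
qed (auto simp: circle_group_def norm_mult)

lemma subgroup_root_group:
  assumes "p > 0"
  shows "subgroup (carrier (root_group p)) circle_group"
proof -
  interpret group circle_group by (rule group_circle_group)
  have inv_eq: "inv\<^bsub>circle_group\<^esub> x = inverse x" if "x \<in> carrier circle_group" for x
    using that by (intro inv_equality) (auto simp: circle_group_def norm_inverse intro!: left_inverse)
  show ?thesis
  proof (rule subgroupI)
    show "carrier (root_group p) \<noteq> {}"
      by (auto simp: root_group_def circle_group_def intro!: exI[of _ 1])
  next
    fix a assume "a \<in> carrier (root_group p)"
    then show "inv\<^bsub>circle_group\<^esub> a \<in> carrier (root_group p)"
      using inv_eq[of a]
      by (auto simp: root_group_def circle_group_def norm_inverse power_inverse)
  qed (auto simp: root_group_def circle_group_def norm_mult power_mult_distrib)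
qed

lemma group_root_group:
  assumes "p > 0"
  shows "group (root_group p)"
  using subgroup.subgroup_is_group[OF subgroup_root_group[OF assms] group_circle_group]
  by (simp add: root_group_def)

lemma inclusion_hom: "(\<lambda>z. z) \<in> hom (root_group p) circle_group"
  by (auto simp: hom_def root_group_def)

lemma compact_circle_group: "compact (carrier circle_group)"
  by (simp add: circle_group_def)

lemma compact_root_group: "compact (carrier (root_group p))"
proof -
  have "closed {z :: complex. z ^ p = 1}"
    by (intro closed_Collect_eq continuous_intros)
  moreover have "carrier (root_group p) = carrier circle_group \<inter> {z. z ^ p = 1}"
    by (auto simp: root_group_def)
  ultimately show ?thesis
    using compact_circle_group by (simp add: compact_Int_closed)
qed

lemma norm_vector_scalar_mult: "norm (c *s x) = norm c * norm x" for x :: "complex ^ 'n"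
  by (simp add: norm_vec_def norm_mult L2_set_right_distrib)

lemma G_space_circle: "G_space circle_group (*s) (sphere (0 :: complex ^ 'n) 1)"
proof -
  have "continuous_on S (\<lambda>(c, x). c *s x)" for S :: "(complex \<times> (complex ^ 'n)) set"
    unfolding vector_scalar_mult_def case_prod_beta by (intro continuous_intros)
  then show ?thesis
    using group_circle_group
    by (auto simp: G_space_def circle_group_def norm_vector_scalar_mult)
qed

lemma G_space_root:
  assumes "p > 0"
  shows "G_space (root_group p) (*s) (sphere (0 :: complex ^ 'n) 1)"
  using G_space_circle[where 'n = 'n] group_root_group[OF assms]
  by (auto simp: G_space_def root_group_def elim!: continuous_on_subset)

lemma equivariant_map_spheres_iff:
  fixes f :: "complex ^ 'n \<Rightarrow> complex ^ 'm"
  assumes "p > 0"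
  shows "equivariant_map (root_group p) circle_group (\<lambda>z. z) (*s) (sphere 0 1) (*s) (sphere 0 1) f
    \<longleftrightarrow> continuous_on (sphere 0 1) f \<and> f \<in> sphere 0 1 \<rightarrow> sphere 0 1 \<and>
        (\<forall>z x. z ^ p = 1 \<and> norm z = 1 \<and> norm x = 1 \<longrightarrow> f (z *s x) = z *s f x)"
  using inclusion_hom[of p] G_space_root[OF assms, where 'n = 'n] G_space_circle[where 'n = 'm]
  by (auto simp: equivariant_map_def root_group_def circle_group_def)

end

theory Submission
  imports Defs "HOL-Homology.Homology"
begin

text \<open>
  For n \<le> m the inclusion of coordinates commutes with all scalars. The content is the
  converse, a theorem of Borsuk-Ulam type: equivariance under the p-th roots of unity already
  forces n \<le> m.

  Write g for multiplication by \<zeta> = exp (2 \<pi> i / p) on the sphere of \<complex>^n and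
  let f be equivariant. The m coordinates of f are sections without common zero of a complex line
  bundle on the lens space, so the m-th power of the Euler class of this bundle vanishes. On the
  other hand, for m < n that power is nonzero modulo p. The proof plays these two facts against
  each other with explicit chains and cochains on the sphere itself.

  Since the sphere has no homology strictly between the degrees 0 and 2n - 1, there are singular
  chains c_0, ..., c_2m on it such that c_0 is a point and the boundary of c_(k+1) is g c_k - c_k
  for even k and the sum of the translates g^i c_k, i < p, for odd k
  (\<open>tower_exists\<close>). Modulo p the chain c_2m becomes a cycle in the quotient; it is
  the class on which the m-th power is tested.

  Each coordinate of f gives a representative, up to sign, of the Euler class: the coboundary of
  the cochain that counts how the coordinate crosses the branch cut of the logarithm along an edge
  (\<open>winding\<close>). The product of the first i representatives takes the value (-1)^i
  modulo p on c_2i (\<open>euler_power_tower\<close>). The reason is that rotation by g moves a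
  point across the cut exactly once in p steps.

  Finally, the representative made from one coordinate is zero on simplices at whose vertices the
  values of that coordinate form acute angles with each other (\<open>cobd_winding_eq_0\<close>).
  By continuity of f, sufficiently fine subdivision makes every simplex of c_2m of this kind for
  at least one coordinate, while the relations between the chains survive
  (\<open>tower_subdivision\<close>). Then the product of all m representatives is zero on c_2m,
  although it should be 1 or -1 modulo p (\<open>no_acute_label_cover\<close>).
\<close>

section \<open>Cochains on vertices of singular simplices\<close>

definition vertices :: "((nat \<Rightarrow> real) \<Rightarrow> 'a) \<Rightarrow> nat \<Rightarrow> 'a" where
  "vertices \<sigma> i = \<sigma> (\<lambda>j. if j = i then 1 else 0)"

text \<open>
  A k-cochain here sees only the k + 1 vertices of a singular simplex, so it is a function of
  vertex sequences that ignores all entries beyond the k-th one. This is what keeps coboundary and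
  product explicit finite formulas.
\<close>

definition cochain :: "nat \<Rightarrow> ((nat \<Rightarrow> 'a) \<Rightarrow> int) \<Rightarrow> bool" where
  "cochain k \<phi> \<longleftrightarrow> (\<forall>v w. (\<forall>i\<le>k. v i = w i) \<longrightarrow> \<phi> v = \<phi> w)"

definition eval_cochain :: "((nat \<Rightarrow> 'a) \<Rightarrow> int) \<Rightarrow> 'a chain \<Rightarrow> int" where
  "eval_cochain \<phi> c = (\<Sum>\<sigma>\<in>Poly_Mapping.keys c. Poly_Mapping.lookup c \<sigma> * \<phi> (vertices \<sigma>))"

definition skip :: "nat \<Rightarrow> nat \<Rightarrow> nat" where
  "skip j i = (if i < j then i else Suc i)"

definition cobd :: "nat \<Rightarrow> ((nat \<Rightarrow> 'a) \<Rightarrow> int) \<Rightarrow> (nat \<Rightarrow> 'a) \<Rightarrow> int" where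
  "cobd k \<phi> v = (\<Sum>j\<le>Suc k. (-1) ^ j * \<phi> (v \<circ> skip j))"

text \<open>
  The Alexander-Whitney formula for the cup product with a d-cochain on the left: front face times
  back face.
\<close>

definition cup :: "nat \<Rightarrow> ((nat \<Rightarrow> 'a) \<Rightarrow> int) \<Rightarrow> ((nat \<Rightarrow> 'a) \<Rightarrow> int) \<Rightarrow> (nat \<Rightarrow> 'a) \<Rightarrow> int" where
  "cup d \<phi> \<psi> v = \<phi> v * \<psi> (\<lambda>i. v (i + d))"

lemma cochainD: "cochain k \<phi> \<Longrightarrow> (\<And>i. i \<le> k \<Longrightarrow> v i = w i) \<Longrightarrow> \<phi> v = \<phi> w"
  by (auto simp: cochain_def)

lemma cochain_cobd:
  assumes "cochain k \<phi>"
  shows "cochain (Suc k) (cobd k \<phi>)"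
  unfolding cochain_def cobd_def
  by (intro allI impI sum.cong refl arg_cong2[where f = "(*)"] cochainD[OF assms])
     (auto simp: skip_def)

lemma cochain_cup:
  assumes "cochain d \<phi>" "cochain q \<psi>"
  shows "cochain (d + q) (cup d \<phi> \<psi>)"
  unfolding cochain_def cup_def
  by (intro allI impI arg_cong2[where f = "(*)"] cochainD[OF assms(1)] cochainD[OF assms(2)]) auto

lemma eval_cochain_superset:
  assumes "finite K" "Poly_Mapping.keys c \<subseteq> K"
  shows "eval_cochain \<phi> c = (\<Sum>\<sigma>\<in>K. Poly_Mapping.lookup c \<sigma> * \<phi> (vertices \<sigma>))"
  unfolding eval_cochain_def
  by (rule sum.mono_neutral_left) (use assms in \<open>auto simp: in_keys_iff\<close>)

lemma eval_cochain_0 [simp]: "eval_cochain \<phi> 0 = 0"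
  by (simp add: eval_cochain_def)

lemma eval_cochain_of [simp]: "eval_cochain \<phi> (frag_of \<sigma>) = \<phi> (vertices \<sigma>)"
  by (simp add: eval_cochain_def)

lemma eval_cochain_add: "eval_cochain \<phi> (a + b) = eval_cochain \<phi> a + eval_cochain \<phi> b"
proof -
  let ?K = "Poly_Mapping.keys a \<union> Poly_Mapping.keys b"
  have "Poly_Mapping.keys (a + b) \<subseteq> ?K"
    by (rule keys_add)
  then show ?thesis
    by (simp add: eval_cochain_superset[of ?K] lookup_add distrib_right sum.distrib)
qed

lemma eval_cochain_diff: "eval_cochain \<phi> (a - b) = eval_cochain \<phi> a - eval_cochain \<phi> b"
  using eval_cochain_add[of \<phi> "a - b" b] by simp

lemma eval_cochain_minus: "eval_cochain \<phi> (- a) = - eval_cochain \<phi> a"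
  using eval_cochain_diff[of \<phi> 0 a] by simp

lemma eval_cochain_sign: "eval_cochain \<phi> (frag_cmul ((-1) ^ j) c) = (-1) ^ j * eval_cochain \<phi> c"
  by (cases "even j") (auto simp: eval_cochain_minus)

lemma eval_cochain_sum: "eval_cochain \<phi> (sum c I) = (\<Sum>i\<in>I. eval_cochain \<phi> (c i))"
  by (induction I rule: infinite_finite_induct) (auto simp: eval_cochain_add)

lemma vertices_in_topspace:
  assumes "singular_simplex k X \<sigma>" "i \<le> k"
  shows "vertices \<sigma> i \<in> topspace X"
  using assms by (auto simp: vertices_def singular_simplex_def continuous_map_def Pi_iff)

lemma eval_cochain_cong:
  assumes "singular_chain k X c"
    and "\<And>v. (\<And>i. i \<le> k \<Longrightarrow> v i \<in> topspace X) \<Longrightarrow> \<phi> v = \<psi> v"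
  shows "eval_cochain \<phi> c = eval_cochain \<psi> c"
  unfolding eval_cochain_def
proof (rule sum.cong[OF refl])
  fix \<sigma> assume "\<sigma> \<in> Poly_Mapping.keys c"
  then have "singular_simplex k X \<sigma>"
    using assms(1) by (auto simp: singular_chain_def)
  then have "\<phi> (vertices \<sigma>) = \<psi> (vertices \<sigma>)"
    by (intro assms(2) vertices_in_topspace)
  then show "Poly_Mapping.lookup c \<sigma> * \<phi> (vertices \<sigma>) = Poly_Mapping.lookup c \<sigma> * \<psi> (vertices \<sigma>)"
    by simp
qed

lemma eval_cochain_chain_map:
  assumes "singular_chain k X c" "cochain k \<phi>"
  shows "eval_cochain \<phi> (chain_map k g c) = eval_cochain (\<lambda>v. \<phi> (g \<circ> v)) c"
  using assms(1) unfolding singular_chain_def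
proof (induction rule: frag_induction)
  case (one \<sigma>)
  have "\<phi> (vertices (simplex_map k g \<sigma>)) = \<phi> (g \<circ> vertices \<sigma>)"
    by (rule cochainD[OF assms(2)]) (simp add: vertices_def simplex_map_def)
  then show ?case
    by (simp add: comp_def)
qed (auto simp: chain_map_diff eval_cochain_diff)

lemma simplical_face_vertex:
  "simplical_face j (\<lambda>l. if l = i then 1 else 0) = (\<lambda>l. if l = skip j i then 1 else (0::real))"
  by (auto simp: simplical_face_def skip_def fun_eq_iff)

lemma eval_cochain_boundary:
  assumes "singular_chain (Suc k) X c" "cochain k \<phi>"
  shows "eval_cochain \<phi> (chain_boundary (Suc k) c) = eval_cochain (cobd k \<phi>) c"
  using assms(1) unfolding singular_chain_def
proof (induction rule: frag_induction)
  case (one \<sigma>)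
  have "\<phi> (vertices (singular_face (Suc k) j \<sigma>)) = \<phi> (vertices \<sigma> \<circ> skip j)" for j
    by (rule cochainD[OF assms(2)]) (simp add: vertices_def singular_face_def simplical_face_vertex)
  then show ?case
    by (simp only: chain_boundary_of eval_cochain_sum eval_cochain_sign eval_cochain_of cobd_def
        nat.distinct if_False)
qed (auto simp: chain_boundary_diff eval_cochain_diff)

lemma sum_lessThan_add: "(\<Sum>j<a + b. f j) = (\<Sum>j<a. f j) + (\<Sum>j<b. f (a + j))"
  for f :: "nat \<Rightarrow> int"
  by (induction b) auto

text \<open>
  The Leibniz rule. Omitting one of the first d + 1 vertices acts on the front factor only,
  omitting a later one on the back factor only. The two faces at the seam, the last one of the
  front factor and the first one of the back factor, occur only on the right-hand side, where they
  cancel.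
\<close>

lemma cobd_cup:
  assumes "cochain d \<phi>"
  shows "cobd (d + q) (cup d \<phi> \<psi>) v =
    cobd d \<phi> v * \<psi> (\<lambda>i. v (i + Suc d)) + (-1) ^ d * \<phi> v * cobd q \<psi> (\<lambda>i. v (i + d))"
proof -
  define T where "T j = (-1) ^ j * cup d \<phi> \<psi> (v \<circ> skip j)" for j
  define A where "A j = (-1) ^ j * \<phi> (v \<circ> skip j)" for j
  define B where "B j = (-1) ^ j * \<psi> ((\<lambda>i. v (i + d)) \<circ> skip j)" for j
  \<comment> \<open>The first \<open>d + 1\<close> faces belong to the front factor, the others to the back factor.\<close>
  have low: "T j = A j * \<psi> (\<lambda>i. v (i + Suc d))" if "j \<le> d" for j
  proof -
    have "(\<lambda>i. (v \<circ> skip j) (i + d)) = (\<lambda>i. v (i + Suc d))"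
      using that by (auto simp: skip_def fun_eq_iff)
    then show ?thesis
      by (simp add: T_def A_def cup_def)
  qed
  have high: "T (d + Suc j) = (-1) ^ d * \<phi> v * B (Suc j)" for j
  proof -
    have "(\<lambda>i. (v \<circ> skip (d + Suc j)) (i + d)) = (\<lambda>i. v (i + d)) \<circ> skip (Suc j)"
      by (auto simp: skip_def fun_eq_iff)
    moreover have "\<phi> (v \<circ> skip (d + Suc j)) = \<phi> v"
      by (rule cochainD[OF assms]) (simp add: skip_def)
    ultimately show ?thesis
      by (simp add: T_def B_def cup_def power_add)
  qed
  have A_last: "A (Suc d) = - ((-1) ^ d * \<phi> v)"
    using cochainD[OF assms, of "v \<circ> skip (Suc d)" v] by (simp add: A_def skip_def)
  have B_0: "B 0 = \<psi> (\<lambda>i. v (i + Suc d))"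
    by (simp add: B_def skip_def comp_def)
  have "cobd (d + q) (cup d \<phi> \<psi>) v = (\<Sum>j<Suc d + Suc q. T j)"
    by (simp add: cobd_def T_def lessThan_Suc_atMost[symmetric])
  also have "\<dots> = (\<Sum>j<Suc d. T j) + (\<Sum>j<Suc q. T (d + Suc j))"
    by (simp only: sum_lessThan_add) simp
  also have "(\<Sum>j<Suc d. T j) = (\<Sum>j\<le>d. A j) * \<psi> (\<lambda>i. v (i + Suc d))"
    unfolding lessThan_Suc_atMost sum_distrib_right by (intro sum.cong refl low) simp
  also have "(\<Sum>j<Suc q. T (d + Suc j)) = (-1) ^ d * \<phi> v * (\<Sum>j\<le>q. B (Suc j))"
    unfolding lessThan_Suc_atMost sum_distrib_left by (intro sum.cong refl high)
  also have "(\<Sum>j\<le>d. A j) = cobd d \<phi> v - A (Suc d)"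
    by (simp add: cobd_def A_def)
  also have "(\<Sum>j\<le>q. B (Suc j)) = cobd q \<psi> (\<lambda>i. v (i + d)) - B 0"
    unfolding cobd_def B_def[symmetric] by (simp only: sum.atMost_Suc_shift)
  finally show ?thesis
    unfolding A_last B_0 by (simp add: algebra_simps)
qed


lemma eval_cochain_cochain_diff:
  "eval_cochain (\<lambda>v. \<phi> v - \<psi> v) c = eval_cochain \<phi> c - eval_cochain \<psi> c"
  by (simp add: eval_cochain_def algebra_simps sum_subtractf)

lemma eval_cochain_cochain_cmul: "eval_cochain (\<lambda>v. a * \<phi> v) c = a * eval_cochain \<phi> c"
  by (simp add: eval_cochain_def algebra_simps sum_distrib_left)

lemma eval_cochain_cochain_sum:
  "eval_cochain (\<lambda>v. \<Sum>i\<in>I. \<phi> i v) c = (\<Sum>i\<in>I. eval_cochain (\<phi> i) c)"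
  unfolding eval_cochain_def by (subst sum.swap) (simp add: sum_distrib_left)

section \<open>Towers of chains for a periodic map\<close>

text \<open>
  The two alternating maps of the periodic resolution of the integers over the group ring of a
  cyclic group, applied to k-chains: g - 1 for even n and the norm 1 + g + ... + g^(p-1) for odd
  n. The degree n of the resolution and the dimension k of the chain are separate arguments
  because a step is also compared with its own boundary, which has dimension k - 1.
\<close>

definition tower_step :: "nat \<Rightarrow> ('a \<Rightarrow> 'a) \<Rightarrow> nat \<Rightarrow> nat \<Rightarrow> 'a chain \<Rightarrow> 'a chain" where
  "tower_step p g n k c = (if even n then chain_map k g c - c else \<Sum>i<p. chain_map k (g ^^ i) c)"

text \<open>
  The image of the generators of the periodic resolution under a chain map from the resolution to
  the singular chains of X, truncated at degree N.
\<close>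

definition tower :: "nat \<Rightarrow> 'a topology \<Rightarrow> ('a \<Rightarrow> 'a) \<Rightarrow> nat \<Rightarrow> (nat \<Rightarrow> 'a chain) \<Rightarrow> bool" where
  "tower p X g N c \<longleftrightarrow>
     (\<forall>k\<le>N. singular_chain k X (c k)) \<and> (\<exists>\<sigma>. singular_simplex 0 X \<sigma> \<and> c 0 = frag_of \<sigma>) \<and>
     (\<forall>k<N. chain_boundary (Suc k) (c (Suc k)) = tower_step p g k k (c k))"

lemma continuous_map_funpow:
  assumes "continuous_map X X g"
  shows "continuous_map X X (g ^^ i)"
proof (induction i)
  case (Suc i)
  then show ?case
    using continuous_map_compose[OF Suc assms] by (simp add: comp_def)
qed (simp add: id_def[symmetric])

lemma singular_chain_tower_step:
  assumes "continuous_map X X g" "singular_chain k X c"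
  shows "singular_chain k X (tower_step p g n k c)"
  unfolding tower_step_def
  by (auto intro!: singular_chain_diff singular_chain_sum singular_chain_chain_map[OF assms(2)]
      continuous_map_funpow assms)

lemma boundary_tower_step:
  assumes "singular_chain (Suc k) X c"
  shows "chain_boundary (Suc k) (tower_step p g n (Suc k) c) =
    tower_step p g n k (chain_boundary (Suc k) c)"
  by (simp add: tower_step_def chain_boundary_diff chain_boundary_sum
      chain_boundary_chain_map[OF assms] comp_def)

text \<open>Both composites of g - 1 and the norm telescope to g^p - 1.\<close>

lemma tower_step_Suc_tower_step:
  assumes "continuous_map X X g" "\<And>x. x \<in> topspace X \<Longrightarrow> (g ^^ p) x = x" "singular_chain k X c"
  shows "tower_step p g (Suc n) k (tower_step p g n k c) = 0"
proof -
  define T where "T i = chain_map k (g ^^ i) c" for i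
  have "T p = c"
    unfolding T_def by (rule chain_map_id_gen[OF assms(3) assms(2)])
  moreover have "T 0 = c"
    unfolding T_def by (rule chain_map_id_gen[OF assms(3)]) simp
  ultimately have telescope: "(\<Sum>i<p. T (Suc i) - T i) = 0"
    by (simp add: sum_lessThan_telescope)
  have left: "chain_map k g (T i) = T (Suc i)" for i
    using chain_map_compose[of k g "g ^^ i"] by (simp add: T_def)
  have right: "chain_map k (g ^^ i) (chain_map k g c) = T (Suc i)" for i
    using chain_map_compose[of k "g ^^ i" g] by (simp add: T_def funpow_swap1 comp_def)
  show ?thesis
  proof (cases "even n")
    case True
    then have "tower_step p g (Suc n) k (tower_step p g n k c) = (\<Sum>i<p. T (Suc i) - T i)"
      by (simp add: tower_step_def chain_map_diff right) (simp add: T_def)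
    with telescope show ?thesis
      by simp
  next
    case False
    then have "tower_step p g (Suc n) k (tower_step p g n k c) = (\<Sum>i<p. T (Suc i) - T i)"
      by (simp add: tower_step_def chain_map_sum comp_def flip: T_def) (simp add: left sum_subtractf)
    with telescope show ?thesis
      by simp
  qed
qed

text \<open>
  Each step of the tower has a cycle to fill: the boundary of one step is the next step of the
  previous one, so two consecutive steps compose to zero. In degree 0 the cycle is a difference of
  two points, which bounds because X is path connected.
\<close>

lemma tower_exists:
  assumes path: "path_connected_space X" and x: "x \<in> topspace X"
    and g: "continuous_map X X g" and period: "\<And>x. x \<in> topspace X \<Longrightarrow> (g ^^ p) x = x"
    and acyclic: "\<And>k z. 0 < k \<Longrightarrow> k < N \<Longrightarrow> singular_relcycle k X {} z \<Longrightarrow> singular_relboundary k X {} z"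
  shows "\<exists>c. tower p X g N c"
  using acyclic
proof (induction N)
  case 0
  define \<sigma> where "\<sigma> = restrict (\<lambda>_. x) (standard_simplex 0)"
  have "singular_simplex 0 X \<sigma>"
    using x by (simp add: singular_simplex_def \<sigma>_def)
  then have "tower p X g 0 (\<lambda>_. frag_of \<sigma>)"
    by (auto simp: tower_def singular_chain_of)
  then show ?case by blast
next
  case (Suc N)
  then obtain c where c: "tower p X g N c"
    by (meson less_SucI)
  have chain: "singular_chain N X (c N)"
    using c by (simp add: tower_def)
  have "singular_relboundary N X {} (tower_step p g N N (c N))"
  proof (cases N)
    case 0
    from c obtain \<sigma> where \<sigma>: "singular_simplex 0 X \<sigma>" "c 0 = frag_of \<sigma>"
      by (auto simp: tower_def)
    have "homologous_rel 0 X {} (frag_of (simplex_map 0 g \<sigma>)) (frag_of \<sigma>)"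
      by (intro iso_integer_zeroth_homology_group_aux path \<sigma> singular_simplex_simplex_map[OF _ g])
    then show ?thesis
      by (simp add: 0 \<sigma> tower_step_def homologous_rel_def)
  next
    case (Suc k)
    have "chain_boundary (Suc k) (c (Suc k)) = tower_step p g k k (c k)" "singular_chain k X (c k)"
      using c by (auto simp: tower_def Suc)
    then have "chain_boundary N (tower_step p g N N (c N)) = 0"
      using boundary_tower_step[of k X "c N" p g N] chain tower_step_Suc_tower_step[OF g period, of k "c k" k]
      by (simp add: Suc)
    then have "singular_relcycle N X {} (tower_step p g N N (c N))"
      by (simp add: singular_cycle singular_chain_tower_step[OF g chain])
    then show ?thesis
      by (intro Suc.prems) (auto simp: Suc)
  qed
  then obtain d where d: "singular_chain (Suc N) X d"
      "chain_boundary (Suc N) d = tower_step p g N N (c N)"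
    by (auto simp: singular_boundary)
  have "tower p X g (Suc N) (c(Suc N := d))"
    using c d by (auto simp: tower_def le_Suc_eq less_Suc_eq)
  then show ?case by blast
qed

lemma singular_subdivision_sum:
  "singular_subdivision k (sum f I) = (\<Sum>i\<in>I. singular_subdivision k (f i))"
  by (induction I rule: infinite_finite_induct) (auto simp: singular_subdivision_add)

text \<open>
  Subdivision is a natural chain map, so it commutes with both kinds of steps, and it fixes
  0-chains.
\<close>

lemma tower_subdivision:
  assumes "tower p X g N c"
  shows "tower p X g N (\<lambda>k. singular_subdivision k (c k))"
  unfolding tower_def
proof (intro conjI allI impI)
  show "singular_chain k X (singular_subdivision k (c k))" if "k \<le> N" for k
    using assms that by (simp add: tower_def singular_chain_singular_subdivision)
  obtain \<sigma> where "singular_simplex 0 X \<sigma>" "c 0 = frag_of \<sigma>"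
    using assms by (auto simp: tower_def)
  then show "\<exists>\<sigma>. singular_simplex 0 X \<sigma> \<and> singular_subdivision 0 (c 0) = frag_of \<sigma>"
    by (metis singular_chain_of singular_subdivision_zero)
next
  fix k assume "k < N"
  then have "singular_chain k X (c k)" "singular_chain (Suc k) X (c (Suc k))"
    "chain_boundary (Suc k) (c (Suc k)) = tower_step p g k k (c k)"
    using assms by (auto simp: tower_def)
  then show "chain_boundary (Suc k) (singular_subdivision (Suc k) (c (Suc k))) =
      tower_step p g k k (singular_subdivision k (c k))"
    by (simp add: chain_boundary_singular_subdivision tower_step_def singular_subdivision_diff
        singular_subdivision_sum naturality_singular_subdivision)
qed

lemma tower_iterated_subdivision:
  assumes "tower p X g N c"
  shows "tower p X g N (\<lambda>k. (singular_subdivision k ^^ r) (c k))"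
  by (induction r) (use assms in \<open>auto dest: tower_subdivision\<close>)

section \<open>The winding cochain\<close>

text \<open>Minus the signed number of crossings of the branch cut of the logarithm on the short arc
from the direction of w (v 0) to that of w (v 1); see \<open>winding_2pi\<close>.\<close>

definition winding :: "('a \<Rightarrow> complex) \<Rightarrow> (nat \<Rightarrow> 'a) \<Rightarrow> int" where
  "winding w v = unwinding (Ln (w (v 1)) - Ln (w (v 0)))"

text \<open>
  The number of times that the point w x crosses the branch cut when it is rotated by the angle 2
  \<pi> k / p; see \<open>sheet_2pi\<close>.
\<close>

definition sheet :: "nat \<Rightarrow> ('a \<Rightarrow> complex) \<Rightarrow> nat \<Rightarrow> 'a \<Rightarrow> int" where
  "sheet p w k x = unwinding (Ln (w x) + 2 * pi * \<i> * (k / p))"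

lemma cochain_winding: "cochain 1 (winding w)"
  by (auto simp: cochain_def winding_def)

lemma cobd_0: "cobd 0 (\<lambda>v. \<theta> (v 0)) v = \<theta> (v 1) - \<theta> (v 0)"
  by (simp add: cobd_def skip_def)

lemma cobd_1: "cobd 1 \<phi> v = \<phi> (v \<circ> skip 0) - \<phi> (v \<circ> skip 1) + \<phi> (v \<circ> skip 2)"
  by (simp add: cobd_def numeral_2_eq_2)

lemma winding_2pi:
  assumes "w (v 0) \<noteq> 0" "w (v 1) \<noteq> 0"
  shows "2 * pi * \<i> * winding w v = Ln (w (v 1)) - Ln (w (v 0)) - Ln (w (v 1) / w (v 0))"
  unfolding winding_def unwinding_2pi using assms by (simp add: exp_diff)

lemma sheet_2pi:
  assumes "w x \<noteq> 0" "p > 0"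
  shows "2 * pi * \<i> * sheet p w k x =
    Ln (w x) + 2 * pi * \<i> * (k / p) - Ln (cis (2 * pi * k / p) * w x)"
  unfolding sheet_def unwinding_2pi using assms
  by (simp add: exp_add cis_conv_exp mult_ac)

text \<open>Identities between these integers are checked after multiplication by the period of the
  exponential function, where they become identities between logarithms.\<close>

lemma of_int_2pi_cancel:
  fixes m n :: int
  assumes "2 * pi * \<i> * m = 2 * pi * \<i> * n"
  shows "m = n"
  using assms by simp

text \<open>
  A rotation preserves the quotient of the two end points, hence the short arc; the crossing
  number changes only through the crossings of the two end points themselves. So the winding
  cochain is invariant up to a coboundary, and its own coboundary is invariant.
\<close>

lemma winding_shift:
  assumes w: "\<And>i. i \<le> 1 \<Longrightarrow> w (v i) \<noteq> 0"
    and h: "\<And>i. i \<le> 1 \<Longrightarrow> w (h (v i)) = cis (2 * pi * k / p) * w (v i)" and p: "p > 0"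
  shows "winding w (h \<circ> v) = winding w v - (sheet p w k (v 1) - sheet p w k (v 0))"
proof (rule of_int_2pi_cancel)
  have ratio: "w (h (v 1)) / w (h (v 0)) = w (v 1) / w (v 0)"
    by (simp add: h)
  have "2 * pi * \<i> * winding w (h \<circ> v) =
      Ln (w (h (v 1))) - Ln (w (h (v 0))) - Ln (w (v 1) / w (v 0))"
    using winding_2pi[of w "h \<circ> v"] w ratio by (simp add: h)
  also have "\<dots> = 2 * pi * \<i> * winding w v
      - (2 * pi * \<i> * sheet p w k (v 1) - 2 * pi * \<i> * sheet p w k (v 0))"
    using winding_2pi[of w v] sheet_2pi[of w "v 1" p k] sheet_2pi[of w "v 0" p k] w p h by simp
  finally show "2 * pi * \<i> * of_int (winding w (h \<circ> v)) =
      2 * pi * \<i> * of_int (winding w v - (sheet p w k (v 1) - sheet p w k (v 0)))"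
    by (simp add: algebra_simps)
qed

lemma sheet_shift:
  assumes w: "w x \<noteq> 0" and g: "w (g x) = cis (2 * pi / p) * w x" and p: "p > 0"
  shows "sheet p w k (g x) = sheet p w (Suc k) x - sheet p w 1 x"
proof (rule of_int_2pi_cancel)
  have "cis (2 * pi * k / p) * cis (2 * pi / p) = cis (2 * pi * Suc k / p)"
    by (simp add: cis_mult add_divide_distrib distrib_left add.commute)
  then have turn: "cis (2 * pi * k / p) * w (g x) = cis (2 * pi * Suc k / p) * w x"
    by (simp add: g mult.assoc[symmetric])
  have nz: "w (g x) \<noteq> 0" and turn1: "cis (2 * pi * real 1 / p) * w x = w (g x)"
    using w g by auto
  have "2 * pi * \<i> * sheet p w k (g x) =
      Ln (w (g x)) + 2 * pi * \<i> * (k / p) - Ln (cis (2 * pi * Suc k / p) * w x)"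
    using sheet_2pi[where w = w, OF nz p, of k] unfolding turn by simp
  moreover have "2 * pi * \<i> * sheet p w 1 x = Ln (w x) + 2 * pi * \<i> * (1 / p) - Ln (w (g x))"
    using sheet_2pi[where w = w, OF w p, of 1] unfolding turn1 by simp
  ultimately show "2 * pi * \<i> * of_int (sheet p w k (g x)) =
      2 * pi * \<i> * of_int (sheet p w (Suc k) x - sheet p w 1 x)"
    using sheet_2pi[where w = w, OF w p, of "Suc k"]
    by (simp add: right_diff_distrib add_divide_distrib distrib_left)
qed

lemma sheet_0: "w x \<noteq> 0 \<Longrightarrow> p > 0 \<Longrightarrow> sheet p w 0 x = 0"
  using sheet_2pi[of w x p 0] by simp

lemma sheet_full_turn: "w x \<noteq> 0 \<Longrightarrow> p > 0 \<Longrightarrow> sheet p w p x = 1"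
  using sheet_2pi[of w x p p] by simp

text \<open>
  The sum telescopes to the crossings of a full turn, of which there is exactly one. This is the
  source of the 1 that keeps the powers of the Euler class nonzero modulo p.
\<close>

lemma sum_sheet_shift:
  assumes "w x \<noteq> 0" "w (g x) = cis (2 * pi / p) * w x" "p > 0"
  shows "(\<Sum>k<p. sheet p w k (g x) - sheet p w k x) = 1 - int p * sheet p w 1 x"
proof -
  have "(\<Sum>k<p. sheet p w k (g x) - sheet p w k x) =
      (\<Sum>k<p. sheet p w (Suc k) x - sheet p w k x) - (\<Sum>k<p. sheet p w 1 x)"
    by (simp add: sheet_shift[where g = g, OF assms] sum_subtractf)
  also have "(\<Sum>k<p. sheet p w (Suc k) x - sheet p w k x) = 1"
    using assms sum_lessThan_telescope[of "\<lambda>k. sheet p w k x" p] by (simp add: sheet_0 sheet_full_turn)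
  finally show ?thesis
    by simp
qed

lemma Ln_times_right_half_plane:
  assumes "Re a > 0" "Re b > 0"
  shows "Ln (a * b) = Ln a + Ln b"
proof -
  have nz: "a \<noteq> 0" "b \<noteq> 0"
    using assms by auto
  have "\<bar>Im (Ln a)\<bar> < pi / 2" "\<bar>Im (Ln b)\<bar> < pi / 2"
    using assms nz Re_Ln_pos_lt by blast+
  then show ?thesis
    using Ln_times[OF nz] by auto
qed

text \<open>
  Short arcs between directions at acute angles add up: the logarithm of a product of two
  quotients with positive real part is the sum of the logarithms.
\<close>

lemma cobd_winding_eq_0:
  assumes "\<And>i j. i \<le> 2 \<Longrightarrow> j \<le> 2 \<Longrightarrow> Re (w (v i) * cnj (w (v j))) > 0"
  shows "cobd 1 (winding w) v = 0"
proof (rule of_int_2pi_cancel)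
  have nz: "w (v i) \<noteq> 0" if "i \<le> 2" for i
    using assms[OF that that] by auto
  have ratio: "Re (w (v i) / w (v j)) > 0" if "i \<le> 2" "j \<le> 2" for i j
    using assms[OF that] nz[OF that(2)] by (subst complex_div_cnj) simp
  have "Ln (w (v 2) / w (v 0)) = Ln (w (v 2) / w (v 1)) + Ln (w (v 1) / w (v 0))"
    using Ln_times_right_half_plane[OF ratio ratio, of 2 1 1 0] nz by simp
  moreover have
    "2 * pi * \<i> * winding w (v \<circ> skip 0) = Ln (w (v 2)) - Ln (w (v 1)) - Ln (w (v 2) / w (v 1))"
    "2 * pi * \<i> * winding w (v \<circ> skip 1) = Ln (w (v 2)) - Ln (w (v 0)) - Ln (w (v 2) / w (v 0))"
    "2 * pi * \<i> * winding w (v \<circ> skip 2) = Ln (w (v 1)) - Ln (w (v 0)) - Ln (w (v 1) / w (v 0))"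
    using winding_2pi[of w "v \<circ> skip 0"] winding_2pi[of w "v \<circ> skip 1"] winding_2pi[of w "v \<circ> skip 2"] nz
    by (simp_all add: skip_def numeral_2_eq_2)
  moreover have "2 * pi * \<i> * of_int (cobd 1 (winding w) v) = 2 * pi * \<i> * winding w (v \<circ> skip 0)
      - 2 * pi * \<i> * winding w (v \<circ> skip 1) + 2 * pi * \<i> * winding w (v \<circ> skip 2)"
    by (simp only: cobd_1 of_int_add of_int_diff ring_distribs)
  ultimately show "2 * pi * \<i> * of_int (cobd 1 (winding w) v) = 2 * pi * \<i> * of_int 0"
    by simp
qed

lemma cobd_cobd_1: "cobd 2 (cobd 1 \<phi>) v = 0" if "cochain 1 \<phi>"
proof -
  have "\<phi> (v \<circ> skip i \<circ> skip j) = \<phi> (v \<circ> skip j \<circ> skip (i - 1))" if "j < i" for i j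
    by (rule cochainD[OF \<open>cochain 1 \<phi>\<close>]) (use that in \<open>auto simp: skip_def\<close>)
  from this[of 0 1] this[of 0 2] this[of 0 3] this[of 1 2] this[of 1 3] this[of 2 3]
  show ?thesis
    by (simp add: cobd_def numeral_2_eq_2 numeral_3_eq_3)
qed

section \<open>Powers of the Euler class\<close>

text \<open>
  The product of the Euler cocycles of the first i labels. The labels are kept different because
  each of them makes the product vanish on other simplices.
\<close>

primrec euler_power :: "(nat \<Rightarrow> 'a \<Rightarrow> complex) \<Rightarrow> nat \<Rightarrow> (nat \<Rightarrow> 'a) \<Rightarrow> int" where
  "euler_power W 0 = (\<lambda>v. 1)"
| "euler_power W (Suc i) = cup (2 * i) (euler_power W i) (cobd 1 (winding (W i)))"

lemma cochain_cobd_winding: "cochain 2 (cobd 1 (winding w))"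
  using cochain_cobd[OF cochain_winding[of w]] by (simp add: numeral_2_eq_2)

lemma cochain_euler_power: "cochain (2 * i) (euler_power W i)"
proof (induction i)
  case 0
  then show ?case by (simp add: cochain_def)
next
  case (Suc i)
  then show ?case
    using cochain_cup[OF Suc cochain_cobd_winding[of "W i"]] by (simp add: add.commute)
qed

lemma cobd_euler_power: "cobd (2 * i) (euler_power W i) v = 0"
proof (induction i arbitrary: v)
  case 0
  then show ?case by (simp add: cobd_def)
next
  case (Suc i)
  have "cobd (2 * i + 2) (euler_power W (Suc i)) v = 0"
    unfolding euler_power.simps cobd_cup[OF cochain_euler_power] Suc cobd_cobd_1[OF cochain_winding]
    by simp
  then show ?case
    by simp
qed

lemma euler_power_eq_0:
  assumes "j < m"
    and "\<And>i l. i \<le> 2 * m \<Longrightarrow> l \<le> 2 * m \<Longrightarrow> Re (W j (v i) * cnj (W j (v l))) > 0"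
  shows "euler_power W m v = 0"
  using assms
proof (induction m)
  case (Suc m)
  show ?case
  proof (cases "j = m")
    case True
    have "cobd 1 (winding (W m)) (\<lambda>i. v (i + 2 * m)) = 0"
      by (rule cobd_winding_eq_0) (use Suc.prems(2) True in auto)
    then show ?thesis
      by (simp add: cup_def)
  next
    case False
    then have "euler_power W m v = 0"
      using Suc.prems by (intro Suc.IH) auto
    then show ?thesis
      by (simp add: cup_def)
  qed
qed simp

text \<open>
  The labels play the role of the coordinates of an equivariant map, modified on their zero sets
  so that logarithms can be taken. The modification destroys continuity there; what is left of it
  are the open sets in \<open>no_acute_label_cover\<close>.
\<close>

locale equivariant_labels =
  fixes X :: "'a topology" and g :: "'a \<Rightarrow> 'a" and p m :: nat and W :: "nat \<Rightarrow> 'a \<Rightarrow> complex"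
  assumes cont_g: "continuous_map X X g"
    and p_pos: "p > 0"
    and W_nonzero: "i < m \<Longrightarrow> x \<in> topspace X \<Longrightarrow> W i x \<noteq> 0"
    and W_equivariant: "i < m \<Longrightarrow> x \<in> topspace X \<Longrightarrow> W i (g x) = cis (2 * pi / p) * W i x"
begin

lemma g_in: "x \<in> topspace X \<Longrightarrow> g x \<in> topspace X"
  using cont_g by (auto simp: continuous_map_def)

lemma funpow_g_in: "x \<in> topspace X \<Longrightarrow> (g ^^ k) x \<in> topspace X"
  by (induction k) (auto intro: g_in)

lemma W_funpow:
  assumes "i < m" "x \<in> topspace X"
  shows "W i ((g ^^ k) x) = cis (2 * pi * k / p) * W i x"
proof (induction k)
  case (Suc k)
  then show ?case
    by (simp add: W_equivariant[OF assms(1) funpow_g_in[OF assms(2)]] cis_mult add_divide_distrib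
        distrib_left mult.assoc[symmetric])
qed simp

lemma winding_funpow:
  assumes "i < m" "\<And>l. l \<le> 1 \<Longrightarrow> v l \<in> topspace X"
  shows "winding (W i) ((g ^^ k) \<circ> v) =
    winding (W i) v - cobd 0 (\<lambda>u. sheet p (W i) k (u 0)) v"
  unfolding cobd_0
  by (intro winding_shift) (auto simp: W_nonzero W_funpow assms p_pos)

lemma cobd_winding_funpow:
  assumes "i < m" "\<And>l. l \<le> 2 \<Longrightarrow> v l \<in> topspace X"
  shows "cobd 1 (winding (W i)) ((g ^^ k) \<circ> v) = cobd 1 (winding (W i)) v"
proof -
  have "winding (W i) ((g ^^ k) \<circ> (v \<circ> skip j)) =
      winding (W i) (v \<circ> skip j) - cobd 0 (\<lambda>u. sheet p (W i) k (u 0)) (v \<circ> skip j)" for j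
    by (intro winding_funpow assms) (simp add: skip_def assms)
  from this[of 0] this[of 1] this[of 2] show ?thesis
    unfolding cobd_1 cobd_0 by (simp add: comp_assoc[symmetric] skip_def numeral_2_eq_2)
qed

lemma euler_power_funpow:
  assumes "i \<le> m" "\<And>l. l \<le> 2 * i \<Longrightarrow> v l \<in> topspace X"
  shows "euler_power W i ((g ^^ k) \<circ> v) = euler_power W i v"
  using assms
proof (induction i)
  case (Suc i)
  have "cobd 1 (winding (W i)) ((g ^^ k) \<circ> (\<lambda>l. v (l + 2 * i))) = cobd 1 (winding (W i)) (\<lambda>l. v (l + 2 * i))"
    using Suc.prems by (intro cobd_winding_funpow) auto
  moreover have "euler_power W i ((g ^^ k) \<circ> v) = euler_power W i v"
    using Suc.prems by (intro Suc.IH) auto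
  ultimately show ?case
    by (simp add: cup_def comp_def)
qed simp

text \<open>
  Let B be the invariant product of the first i cocycles, \<alpha> the next winding cochain and
  \<theta> k the sheet function of its label. Evaluating the next product on the chain of degree
  2i + 2 means evaluating the product of B and \<alpha> on its boundary, a sum of p translates of
  the chain of degree 2i + 1. By \<open>winding_funpow\<close> each translate contributes the same
  value, which adds up to a multiple of p, up to a correction by the coboundary of the product of
  B and \<theta> k. The correction is evaluated on the boundary g c - c of that chain, where c is
  the chain of degree 2i, and \<open>sum_sheet_shift\<close> turns the sum of the corrections into
  the value of B on c modulo p.
\<close>

lemma euler_power_step:
  assumes c: "tower p X g N c" and i: "i < m" "2 * Suc i \<le> N"
  shows "int p dvd eval_cochain (euler_power W (Suc i)) (c (2 * Suc i)) +
    eval_cochain (euler_power W i) (c (2 * i))"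
proof -
  define d where "d = 2 * i"
  define B where "B = euler_power W i"
  define \<alpha> where "\<alpha> = winding (W i)"
  define \<theta> where "\<theta> k u = sheet p (W i) k (u 0)" for k and u :: "nat \<Rightarrow> 'a"
  have B: "cochain d B" "cobd d B v = 0" for v
    by (simp_all add: B_def d_def cochain_euler_power cobd_euler_power)
  have \<alpha>: "cochain (Suc d) (cup d B \<alpha>)"
    using cochain_cup[OF B(1) cochain_winding] by (simp add: \<alpha>_def)
  have \<theta>: "cochain d (cup d B (\<theta> k))" for k
    using cochain_cup[OF B(1), of 0 "\<theta> k"] by (simp add: \<theta>_def cochain_def)
  have sign: "(-1::int) ^ d = 1"
    by (simp add: d_def)
  have chain: "singular_chain k X (c k)" if "k \<le> d + 2" for k
    using c i that by (simp add: tower_def d_def)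
  have boundary2: "chain_boundary (Suc (Suc d)) (c (Suc (Suc d))) =
      (\<Sum>k<p. chain_map (Suc d) (g ^^ k) (c (Suc d)))"
    using c i by (simp add: tower_def tower_step_def d_def)
  have boundary1: "chain_boundary (Suc d) (c (Suc d)) = chain_map d g (c d) - c d"
    using c i by (simp add: tower_def tower_step_def d_def)

  \<comment> \<open>One translate, with the correction pushed down to the chain of degree \<open>d\<close>.\<close>
  have slide: "eval_cochain (\<lambda>v. cup d B \<alpha> ((g ^^ k) \<circ> v)) (c (Suc d)) =
      eval_cochain (cup d B \<alpha>) (c (Suc d)) -
      eval_cochain (\<lambda>v. B v * (\<theta> k (\<lambda>l. g (v (l + d))) - \<theta> k (\<lambda>l. v (l + d)))) (c d)" for k
  proof -
    have "cup d B \<alpha> ((g ^^ k) \<circ> v) = cup d B \<alpha> v - cobd d (cup d B (\<theta> k)) v"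
      if v: "\<And>l. l \<le> Suc d \<Longrightarrow> v l \<in> topspace X" for v
    proof -
      have "\<alpha> ((g ^^ k) \<circ> (\<lambda>l. v (l + d))) = \<alpha> (\<lambda>l. v (l + d)) - cobd 0 (\<theta> k) (\<lambda>l. v (l + d))"
        unfolding \<alpha>_def \<theta>_def using i v by (intro winding_funpow) auto
      moreover have "B ((g ^^ k) \<circ> v) = B v"
        unfolding B_def using i v by (intro euler_power_funpow) (auto simp: d_def)
      moreover have "cup d B \<alpha> ((g ^^ k) \<circ> v) =
          B ((g ^^ k) \<circ> v) * \<alpha> ((g ^^ k) \<circ> (\<lambda>l. v (l + d)))"
        by (simp add: cup_def comp_def)
      ultimately show ?thesis
        using cobd_cup[OF B(1), of 0 "\<theta> k" v]
        by (simp add: cup_def B(2) sign right_diff_distrib)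
    qed
    then have "eval_cochain (\<lambda>v. cup d B \<alpha> ((g ^^ k) \<circ> v)) (c (Suc d)) =
        eval_cochain (cup d B \<alpha>) (c (Suc d)) - eval_cochain (cobd d (cup d B (\<theta> k))) (c (Suc d))"
      unfolding eval_cochain_cochain_diff[symmetric] by (intro eval_cochain_cong[OF chain]) auto
    also have "eval_cochain (cobd d (cup d B (\<theta> k))) (c (Suc d)) =
        eval_cochain (\<lambda>v. cup d B (\<theta> k) (g \<circ> v) - cup d B (\<theta> k) v) (c d)"
      using eval_cochain_boundary[OF chain \<theta>, of k] boundary1
      by (simp add: eval_cochain_diff eval_cochain_chain_map[OF chain \<theta>] eval_cochain_cochain_diff)
    also have "\<dots> = eval_cochain (\<lambda>v. B v * (\<theta> k (\<lambda>l. g (v (l + d))) - \<theta> k (\<lambda>l. v (l + d)))) (c d)"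
    proof (rule eval_cochain_cong[OF chain])
      fix v assume v: "\<And>l. l \<le> d \<Longrightarrow> v l \<in> topspace X"
      have "B (g \<circ> v) = B v"
        using euler_power_funpow[of i v 1] i v by (simp add: B_def d_def)
      then show "cup d B (\<theta> k) (g \<circ> v) - cup d B (\<theta> k) v =
          B v * (\<theta> k (\<lambda>l. g (v (l + d))) - \<theta> k (\<lambda>l. v (l + d)))"
        by (simp add: cup_def comp_def algebra_simps)
    qed simp
    finally show ?thesis .
  qed

  have "eval_cochain (euler_power W (Suc i)) (c (2 * Suc i)) =
      eval_cochain (cobd (Suc d) (cup d B \<alpha>)) (c (Suc (Suc d)))"
    using cobd_cup[OF B(1), of 1 \<alpha>]
    by (simp add: cobd_euler_power cup_def B_def \<alpha>_def d_def eval_cochain_def)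
  also have "\<dots> = (\<Sum>k<p. eval_cochain (\<lambda>v. cup d B \<alpha> ((g ^^ k) \<circ> v)) (c (Suc d)))"
    using eval_cochain_boundary[OF chain \<alpha>] boundary2
    by (simp add: eval_cochain_sum eval_cochain_chain_map[OF chain \<alpha>])
  also have "\<dots> = int p * eval_cochain (cup d B \<alpha>) (c (Suc d)) -
      eval_cochain (\<lambda>v. \<Sum>k<p. B v * (\<theta> k (\<lambda>l. g (v (l + d))) - \<theta> k (\<lambda>l. v (l + d)))) (c d)"
    by (simp add: slide sum_subtractf eval_cochain_cochain_sum)
  also have "eval_cochain (\<lambda>v. \<Sum>k<p. B v * (\<theta> k (\<lambda>l. g (v (l + d))) - \<theta> k (\<lambda>l. v (l + d)))) (c d) =
      eval_cochain (\<lambda>v. B v - int p * (B v * sheet p (W i) 1 (v d))) (c d)"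
  proof (rule eval_cochain_cong[OF chain])
    fix v assume v: "\<And>l. l \<le> d \<Longrightarrow> v l \<in> topspace X"
    have "(\<Sum>k<p. sheet p (W i) k (g (v d)) - sheet p (W i) k (v d)) = 1 - int p * sheet p (W i) 1 (v d)"
      using i v p_pos by (intro sum_sheet_shift) (auto simp: W_nonzero W_equivariant)
    moreover have "(\<Sum>k<p. B v * (\<theta> k (\<lambda>l. g (v (l + d))) - \<theta> k (\<lambda>l. v (l + d)))) =
        B v * (\<Sum>k<p. sheet p (W i) k (g (v d)) - sheet p (W i) k (v d))"
      unfolding \<theta>_def sum_distrib_left by simp
    ultimately show "(\<Sum>k<p. B v * (\<theta> k (\<lambda>l. g (v (l + d))) - \<theta> k (\<lambda>l. v (l + d)))) =
        B v - int p * (B v * sheet p (W i) 1 (v d))"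
      by (simp add: right_diff_distrib)
  qed simp
  also have "\<dots> = eval_cochain B (c d) - int p * eval_cochain (\<lambda>v. B v * sheet p (W i) 1 (v d)) (c d)"
    by (simp add: eval_cochain_cochain_diff eval_cochain_cochain_cmul)
  finally have "eval_cochain (euler_power W (Suc i)) (c (2 * Suc i)) + eval_cochain B (c d) =
      int p * (eval_cochain (cup d B \<alpha>) (c (Suc d)) + eval_cochain (\<lambda>v. B v * sheet p (W i) 1 (v d)) (c d))"
    by (simp add: algebra_simps)
  then show ?thesis
    unfolding B_def d_def by simp
qed

lemma euler_power_tower:
  assumes "tower p X g N c" "i \<le> m" "2 * i \<le> N"
  shows "int p dvd eval_cochain (euler_power W i) (c (2 * i)) - (-1) ^ i"
  using assms(2,3)
proof (induction i)
  case 0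
  then show ?case
    using assms(1) by (auto simp: tower_def)
next
  case (Suc i)
  then have "int p dvd eval_cochain (euler_power W i) (c (2 * i)) - (-1) ^ i"
    by simp
  moreover have "int p dvd eval_cochain (euler_power W (Suc i)) (c (2 * Suc i)) +
      eval_cochain (euler_power W i) (c (2 * i))"
    using Suc.prems by (intro euler_power_step[OF assms(1)]) auto
  ultimately have "int p dvd (eval_cochain (euler_power W (Suc i)) (c (2 * Suc i)) +
      eval_cochain (euler_power W i) (c (2 * i))) - (eval_cochain (euler_power W i) (c (2 * i)) - (-1) ^ i)"
    by (rule dvd_diff[rotated])
  then show ?case
    by simp
qed

text \<open>
  An index theorem for an action of a cyclic group on a space without reduced homology below
  degree 2m: m equivariant labels cannot be arranged so that locally the values of one of them
  form acute angles with each other.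
\<close>

theorem no_acute_label_cover:
  assumes "p \<ge> 2" and path: "path_connected_space X" and nonempty: "topspace X \<noteq> {}"
    and period: "\<And>x. x \<in> topspace X \<Longrightarrow> (g ^^ p) x = x"
    and acyclic: "\<And>k z. 0 < k \<Longrightarrow> k < 2 * m \<Longrightarrow> singular_relcycle k X {} z \<Longrightarrow> singular_relboundary k X {} z"
    and cover: "\<And>x. x \<in> topspace X \<Longrightarrow> \<exists>U. openin X U \<and> x \<in> U \<and>
      (\<exists>i<m. \<forall>y\<in>U. \<forall>z\<in>U. Re (W i y * cnj (W i z)) > 0)"
  shows False
proof -
  obtain c where c: "tower p X g (2 * m) c"
    using tower_exists[OF path _ cont_g period acyclic] nonempty by blast
  define \<C> where "\<C> = {U. openin X U \<and> (\<exists>i<m. \<forall>y\<in>U. \<forall>z\<in>U. Re (W i y * cnj (W i z)) > 0)}"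
  obtain r where r: "\<exists>U\<in>\<C>. \<sigma> \<in> standard_simplex (2 * m) \<rightarrow> U"
    if "\<sigma> \<in> Poly_Mapping.keys ((singular_subdivision (2 * m) ^^ r) (c (2 * m)))" for \<sigma>
  proof (rule sufficient_iterated_singular_subdivision_exists)
    show "openin X U" if "U \<in> \<C>" for U
      using that by (simp add: \<C>_def)
    show "topspace X \<subseteq> \<Union>\<C>"
      using cover by (force simp: \<C>_def)
    show "singular_chain (2 * m) X (c (2 * m))"
      using c by (simp add: tower_def)
  qed blast
  \<comment> \<open>All chains of the tower are subdivided equally often, so that the relations between them persist;
    only the top one has to have small simplices.\<close>
  define c' where "c' k = (singular_subdivision k ^^ r) (c k)" for k
  have "tower p X g (2 * m) c'"
    unfolding c'_def by (rule tower_iterated_subdivision[OF c])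
  then have "int p dvd eval_cochain (euler_power W m) (c' (2 * m)) - (-1) ^ m"
    by (intro euler_power_tower) auto
  moreover have "eval_cochain (euler_power W m) (c' (2 * m)) = 0"
    unfolding eval_cochain_def
  proof (rule sum.neutral, rule ballI)
    fix \<sigma> assume "\<sigma> \<in> Poly_Mapping.keys (c' (2 * m))"
    then obtain U i where U: "\<sigma> \<in> standard_simplex (2 * m) \<rightarrow> U" "i < m"
        "\<forall>y\<in>U. \<forall>z\<in>U. Re (W i y * cnj (W i z)) > 0"
      using r[of \<sigma>] unfolding c'_def \<C>_def by blast
    have "vertices \<sigma> l \<in> U" if "l \<le> 2 * m" for l
      using U(1) that by (auto simp: vertices_def Pi_iff)
    then have "euler_power W m (vertices \<sigma>) = 0"
      using U(2,3) by (intro euler_power_eq_0[of i]) auto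
    then show "Poly_Mapping.lookup (c' (2 * m)) \<sigma> * euler_power W m (vertices \<sigma>) = 0"
      by simp
  qed
  ultimately have "int p dvd (-1) ^ m"
    by simp
  then have "int p dvd 1"
    by (cases "even m") auto
  then show False
    using \<open>p \<ge> 2\<close> by (simp add: zdvd1_eq)
qed

end


section \<open>Spheres\<close>

text \<open>
  The known homology of the standard sphere, translated from groups to cycles and boundaries, and
  from the standard sphere to the unit sphere of a Euclidean space.
\<close>

lemma sphere_acyclic:
  assumes k: "0 < k" "Suc k < DIM('b)"
    and z: "singular_relcycle k (top_of_set (sphere (0::'b::euclidean_space) 1)) {} z"
  shows "singular_relboundary k (top_of_set (sphere (0::'b) 1)) {} z"
proof -
  let ?S = "top_of_set (sphere (0::'b) 1)"
  obtain f :: "(nat \<Rightarrow> real) \<Rightarrow> 'b" and h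
    where "homeomorphic_maps (nsphere (DIM('b) - 1)) (top_of_set (sphere 0 1 \<inter> span Basis)) f h"
    by (rule homeomorphic_maps_nsphere_euclidean_sphere[of "Basis :: 'b set" "DIM('b)"])
       (auto simp: independent_Basis pairwise_def orthogonal_def inner_not_same_Basis)
  then have "nsphere (DIM('b) - 1) homeomorphic_space ?S"
    by (auto simp: homeomorphic_space_def)
  then have "trivial_group (reduced_homology_group (int k) ?S)"
    using k by (subst isomorphic_group_triviality[OF homeomorphic_space_imp_isomorphic_reduced_homology_groups, symmetric])
      (auto intro!: reduced_homology_group_nsphere(2))
  then have "trivial_group (homology_group (int k) ?S)"
    using k by (simp add: un_reduced_homology_group)
  moreover have "homologous_rel_set k ?S {} z \<in> carrier (homology_group (int k) ?S)"
    using z by (auto simp: carrier_relative_homology_group)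
  ultimately have "homologous_rel_set k ?S {} z = singular_relboundary_set k ?S {}"
    by (simp add: trivial_group_def)
  then show ?thesis
    by (simp only: homologous_rel_set_eq_relboundary)
qed

text \<open>
  The real part is the inner product of a and b. Both points differ from c by less than a third of
  its length, so this product is at least 1 - 1/3 - 1/3 - 1/9 times the square of that length.
\<close>

lemma Re_mult_cnj_pos:
  assumes "c \<noteq> 0" "dist c a < norm c / 3" "dist c b < norm c / 3"
  shows "Re (a * cnj b) > 0"
proof -
  define u v where "u = a - c" and "v = b - c"
  have small: "norm u < norm c / 3" "norm v < norm c / 3"
    using assms by (simp_all add: u_def v_def dist_norm norm_minus_commute)
  have "\<bar>u \<bullet> c\<bar> \<le> norm c / 3 * norm c"
    by (rule order_trans[OF Cauchy_Schwarz_ineq2 mult_mono]) (use small in auto)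
  moreover have "\<bar>c \<bullet> v\<bar> \<le> norm c * (norm c / 3)"
    by (rule order_trans[OF Cauchy_Schwarz_ineq2 mult_mono]) (use small in auto)
  moreover have "\<bar>u \<bullet> v\<bar> \<le> norm c / 3 * (norm c / 3)"
    by (rule order_trans[OF Cauchy_Schwarz_ineq2 mult_mono]) (use small in auto)
  moreover have "norm c * norm c > 0"
    using assms(1) by simp
  moreover have "a \<bullet> b = norm c * norm c + u \<bullet> c + c \<bullet> v + u \<bullet> v"
    by (simp add: u_def v_def inner_diff_left inner_diff_right inner_commute dot_square_norm
        flip: power2_eq_square)
  ultimately have "a \<bullet> b > 0"
    by (simp add: abs_le_iff)
  then show ?thesis
    by (simp add: inner_complex_def)
qed

text \<open>
  The labels are the coordinates of f. Near a point at which a coordinate is nonzero, its values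
  form acute angles with each other by continuity.
\<close>

lemma equivariant_sphere_map_card_le:
  fixes f :: "complex ^ 'n \<Rightarrow> complex ^ 'm"
  assumes p: "p \<ge> 2" and cont: "continuous_on (sphere 0 1) f" and f: "f \<in> sphere 0 1 \<rightarrow> sphere 0 1"
    and equivariant: "\<And>z x. z ^ p = 1 \<Longrightarrow> norm z = 1 \<Longrightarrow> norm x = 1 \<Longrightarrow> f (z *s x) = z *s f x"
  shows "CARD('n) \<le> CARD('m)"
proof (rule ccontr)
  assume less: "\<not> CARD('n) \<le> CARD('m)"
  define X where "X = top_of_set (sphere (0 :: complex ^ 'n) 1)"
  define \<zeta> where "\<zeta> = cis (2 * pi / p)"
  define g where "g = (\<lambda>x :: complex ^ 'n. \<zeta> *s x)"
  obtain h where h: "bij_betw h {..<CARD('m)} (UNIV :: 'm set)"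
    using ex_bij_betw_nat_finite[of "UNIV :: 'm set"] by (auto simp: atLeast0LessThan)
  \<comment> \<open>At zeros of a coordinate some nonzero equivariant value must be substituted. A nonzero
    coordinate serves if its index is chosen from the support of \<open>f x\<close> only, as scalars
    preserve the support.\<close>
  define L where "L y = (SOME l. y $ l \<noteq> 0)" for y :: "complex ^ 'm"
  define W where "W i x = (if f x $ h i \<noteq> 0 then f x $ h i else f x $ L (f x))" for i x
  have "\<zeta> ^ p = cis (real p * (2 * pi / p))"
    by (simp only: \<zeta>_def Complex.DeMoivre)
  then have \<zeta>: "\<zeta> ^ p = 1" "norm \<zeta> = 1"
    using p by (simp_all add: \<zeta>_def)
  have topspace: "x \<in> topspace X \<longleftrightarrow> norm x = 1" for x
    by (simp add: X_def)
  have norm_f: "norm (f x) = 1" if "norm x = 1" for x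
    using f that by (auto simp: Pi_iff)
  have f_scale: "f (g x) = \<zeta> *s f x" if "norm x = 1" for x
    using equivariant[OF \<zeta> that] by (simp add: g_def)
  have L: "y $ L y \<noteq> 0" if "norm y = 1" for y
  proof -
    have "y \<noteq> 0"
      using that by auto
    then show ?thesis
      unfolding L_def by (intro someI_ex[of "\<lambda>l. y $ l \<noteq> 0"]) (simp add: vec_eq_iff)
  qed
  have L_scale: "L (\<zeta> *s y) = L y" for y
  proof -
    have "\<zeta> \<noteq> 0"
      using \<zeta>(2) by auto
    then show ?thesis
      by (simp add: L_def)
  qed
  have g_cont: "continuous_map X X g"
    unfolding X_def g_def vector_scalar_mult_def
    by (auto simp: norm_vector_scalar_mult[unfolded vector_scalar_mult_def] \<zeta> intro!: continuous_intros)
  interpret equivariant_labels X g p "CARD('m)" W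
  proof
    show "W i x \<noteq> 0" if "x \<in> topspace X" for i x
      using L[OF norm_f] that by (auto simp: W_def topspace)
    show "W i (g x) = cis (2 * pi / p) * W i x" if "x \<in> topspace X" for i x
      unfolding \<zeta>_def[symmetric] using that \<zeta> by (auto simp: W_def topspace f_scale L_scale)
  qed (use g_cont p in auto)
  have dim: "2 * CARD('m) < 2 * CARD('n) - 1"
    using less by simp
  show False
  proof (rule no_acute_label_cover[OF p])
    show "path_connected_space X"
    proof -
      have "path_connected (sphere (0 :: complex ^ 'n) 1)"
        using dim by (intro path_connected_sphere) auto
      then show ?thesis
        by (simp add: X_def flip: path_connectedin_topspace)
    qed
    show "topspace X \<noteq> {}"
      unfolding X_def by simp
    have "(g ^^ k) x = \<zeta> ^ k *s x" for k x
      by (induction k) (auto simp: g_def vector_smult_assoc)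
    then show "(g ^^ p) x = x" for x
      by (simp add: \<zeta>)
    show "singular_relboundary k X {} z" if "0 < k" "k < 2 * CARD('m)" "singular_relcycle k X {} z" for k z
      using that dim unfolding X_def by (intro sphere_acyclic) auto
  next
    fix x assume x: "x \<in> topspace X"
    then obtain l where l: "f x $ l \<noteq> 0"
      using L[OF norm_f] topspace by blast
    obtain i where i: "i < CARD('m)" "h i = l"
      using h by (metis UNIV_I bij_betw_iff_bijections lessThan_iff)
    define e where "e = norm (f x $ l) / 3"
    define U where "U = {y \<in> sphere 0 1. f y $ l \<in> ball (f x $ l) e}"
    have "continuous_on (sphere 0 1) (\<lambda>y. f y $ l)"
      by (intro continuous_intros cont)
    then have "openin X U"
      unfolding X_def U_def
      using continuous_openin_preimage_gen[of "sphere 0 1" "\<lambda>y. f y $ l" "ball (f x $ l) e"]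
      by (simp add: vimage_def Int_def)
    moreover have "x \<in> U"
      using x l by (simp add: U_def e_def topspace)
    moreover have "Re (W i y * cnj (W i z)) > 0" if "y \<in> U" "z \<in> U" for y z
    proof -
      have "Re (f y $ l * cnj (f z $ l)) > 0"
        using that l by (intro Re_mult_cnj_pos[of "f x $ l"]) (auto simp: U_def e_def)
      then show ?thesis
        by (auto simp: W_def i(2))
    qed
    ultimately show "\<exists>U. openin X U \<and> x \<in> U \<and> (\<exists>i<CARD('m). \<forall>y\<in>U. \<forall>z\<in>U. Re (W i y * cnj (W i z)) > 0)"
      using i(1) by blast
  qed
qed

theorem proposition5p1:
  fixes p :: nat
  assumes "prime p" and "odd p"
  shows "(\<exists>f :: complex ^ 'n \<Rightarrow> complex ^ 'm.
            equivariant_map (root_group p) circle_group (\<lambda>z. z)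
              (*s) (sphere 0 1) (*s) (sphere 0 1) f)
         \<longleftrightarrow> CARD('n) \<le> CARD('m)"
proof
  have p: "p > 0" "p \<ge> 2"
    using assms(1) prime_gt_0_nat prime_ge_2_nat by blast+
  show "CARD('n) \<le> CARD('m)"
    if "\<exists>f :: complex ^ 'n \<Rightarrow> complex ^ 'm.
          equivariant_map (root_group p) circle_group (\<lambda>z. z) (*s) (sphere 0 1) (*s) (sphere 0 1) f"
    using that equivariant_sphere_map_card_le[OF p(2)]
    unfolding equivariant_map_spheres_iff[OF p(1)] by blast
  show "\<exists>f :: complex ^ 'n \<Rightarrow> complex ^ 'm.
          equivariant_map (root_group p) circle_group (\<lambda>z. z) (*s) (sphere 0 1) (*s) (sphere 0 1) f"
    if card: "CARD('n) \<le> CARD('m)"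
  proof -
    obtain h :: "'n \<Rightarrow> 'm" where h: "inj h"
      using card_le_inj[of "UNIV :: 'n set" "UNIV :: 'm set"] card by auto
    define f where "f x = (\<chi> l. if l \<in> range h then x $ inv_into UNIV h l else 0)"
      for x :: "complex ^ 'n"
    have norm: "norm (f x) = norm x" for x
    proof -
      have "(\<Sum>l\<in>UNIV. (norm (f x $ l))\<^sup>2) = (\<Sum>l\<in>range h. (norm (f x $ l))\<^sup>2)"
        by (rule sum.mono_neutral_right) (auto simp: f_def)
      also have "\<dots> = (\<Sum>l\<in>UNIV. (norm (x $ l))\<^sup>2)"
        using h by (simp add: sum.reindex f_def)
      finally show ?thesis
        by (simp add: norm_vec_def L2_set_def)
    qed
    have "continuous_on (sphere 0 1) (\<lambda>x. if l \<in> range h then x $ inv_into UNIV h l else 0)" for l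
      by (cases "l \<in> range h") (auto intro!: continuous_intros)
    then have "continuous_on (sphere 0 1) f"
      unfolding f_def by (rule continuous_on_vec_lambda)
    moreover have "f (z *s x) = z *s f x" for z x
      by (simp add: f_def vec_eq_iff)
    ultimately show ?thesis
      unfolding equivariant_map_spheres_iff[OF p(1)] by (intro exI[of _ f]) (simp add: norm)
  qed
qed

end
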